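(* (1) For all integers $1\le k<n$ we have $f_k(n)\le (M_{k,n})^n$. (2) For every integer $k\ge 1$ and every real number $x\ge k+1$, $$\sum_{k<n\le x}f_k(n)\le \sum_{1\le l\le \max_{k<n\le x}N_{k,n}^{(0)}}f(l),$$ where $n$ and $l$ run over integers.
   Context: For $1\le j\le n$, $\sigma_j(x_1,\dots,x_n)=\sum_{1\le i_1<\dots<i_j\le n}x_{i_1}\cdots x_{i_j}$. For integers $1\le k<n$ let $\mathcal{S}_{k,n}$ be the set of $n$-tuples of integers $(x_1,\dots,x_n)$ with $1\le x_1\le\dots\le x_n$ and $\sigma_k(x_1,\dots,x_n)=\sigma_n(x_1,\dots,x_n)$; this set is finite and nonempty. Put $f_k(n)=|\mathcal{S}_{k,n}|$, $M_{k,n}=\max\{x_n:(x_1,\dots,x_n)\in\mathcal{S}_{k,n}\}$ and $N_{k,n}^{(0)}=\max\{x_1x_2\cdots x_n:(x_1,\dots,x_n)\in\mathcal{S}_{k,n}\}$. For a positive integer $m$, $f(m)$ (without subscript) denotes the number of factorizations of $m$ into integer factors larger than $1$, where the order of the factors does not count (i.e. the number of multisets of integers $>1$ with product $m$); $f(1)=1$. *)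

theory Defs
  imports Complex_Main "HOL-Library.Multiset"
begin

text \<open>
  An \<open>n\<close>-tuple \<open>(x\<^sub>1, \<dots>, x\<^sub>n)\<close> is a list of length \<open>n\<close>, indexed from \<open>0\<close>.  All integers
  involved are positive, so they are taken in \<^typ>\<open>nat\<close>.
\<close>

text \<open>
  Increasing index sequences \<open>i\<^sub>1 < \<dots> < i\<^sub>j\<close> are identified with \<open>j\<close>-element index sets.
\<close>

definition esym :: "nat \<Rightarrow> nat list \<Rightarrow> nat" where
  "esym j xs = (\<Sum>I | I \<subseteq> {..<length xs} \<and> card I = j. \<Prod>i\<in>I. xs ! i)"

definition sol :: "nat \<Rightarrow> nat \<Rightarrow> nat list set" where
  "sol k n = {xs. length xs = n \<and> sorted xs \<and> (\<forall>x\<in>set xs. 1 \<le> x) \<and> esym k xs = esym n xs}"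

definition num_sol :: "nat \<Rightarrow> nat \<Rightarrow> nat" where
  "num_sol k n = card (sol k n)"

text \<open>
  For \<open>1 \<le> k < n\<close> the set \<^term>\<open>sol k n\<close> is finite and nonempty, so the following maxima exist;
  outside this range their values are irrelevant.
\<close>

definition max_entry :: "nat \<Rightarrow> nat \<Rightarrow> nat" where
  "max_entry k n = Max {last xs | xs. xs \<in> sol k n}"

definition max_product :: "nat \<Rightarrow> nat \<Rightarrow> nat" where
  "max_product k n = Max {prod_list xs | xs. xs \<in> sol k n}"

definition num_factorizations :: "nat \<Rightarrow> nat" where
  "num_factorizations m = card {A :: nat multiset. (\<forall>a\<in>#A. 1 < a) \<and> prod_mset A = m}"

end

theory Submission
  imports Defs
begin

text \<open>
  (1) A solution is a list of length \<open>n\<close> with entries in \<open>{1..M}\<close>.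
  (2) Send a solution to the multiset of its entries greater than 1, a factorization of its product.
  For fixed \<open>k\<close> this is injective even on the union over all \<open>n\<close>: adding further ones to a tuple
  leaves the product \<open>\<sigma>\<^sub>n\<close> unchanged but strictly increases \<open>\<sigma>\<^sub>k\<close>.
\<close>

lemma esym_length: "esym (length xs) xs = prod_list xs"
proof -
  have "{I. I \<subseteq> {..<length xs} \<and> card I = length xs} = {{..<length xs}}"
    using card_subset_eq[of "{..<length xs}"] by auto
  then show ?thesis
    by (simp add: esym_def prod.list_conv_set_nth atLeast0LessThan)
qed

lemma esym_pos:
  assumes "j \<le> length xs" and "\<forall>x\<in>set xs. 1 \<le> x"
  shows "0 < esym j xs"
  unfolding esym_def
\<comment> \<open>One positive summand suffices; the first \<open>j\<close> positions form an
  admissible index set because \<open>j\<close> is at most the length.\<close>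
proof (rule sum_pos2[where i = "{..<j}"])
  have "\<forall>i < length xs. 0 < xs ! i"
    using assms(2) by (auto simp: Suc_le_eq)
  then show "0 < (\<Prod>i\<in>{..<j}. xs ! i)"
    using assms(1) by (intro prod_pos) auto
qed (use assms(1) in auto)

text \<open>Index sets are split by whether they contain 0, the position of \<open>x\<close>. The
  remaining indices are shifted by \<open>Suc\<close>: \<open>?f\<close> produces the sets avoiding
  0, \<open>?g\<close> those containing it.\<close>

lemma esym_Cons: "esym (Suc j) (x # xs) = esym (Suc j) xs + x * esym j xs"
proof -
  define S where "S i = {I. I \<subseteq> {..<length xs} \<and> card I = i}" for i
  define T where "T = {I. I \<subseteq> {..<length (x # xs)} \<and> card I = Suc j}"
  let ?f = "\<lambda>I. Suc ` I" and ?g = "\<lambda>I. insert 0 (Suc ` I)"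
  have fin: "finite (S i)" for i
    unfolding S_def by simp
  have finI: "finite I" if "I \<in> S i" for I i
    using that unfolding S_def by (auto intro: finite_subset)
  have inj_f: "inj_on ?f (S (Suc j))"
    by (auto simp: inj_on_def inj_image_eq_iff)
  have inj_g: "inj_on ?g (S j)"
  proof (rule inj_onI)
    fix I J assume "?g I = ?g J"
    then have "Suc ` I = Suc ` J"
      by (subst (asm) insert_ident) auto
    then show "I = J" by (simp add: inj_image_eq_iff)
  qed
  have "T = ?f ` S (Suc j) \<union> ?g ` S j"
  proof (intro equalityI subsetI)
    fix I assume I: "I \<in> T"
    \<comment> \<open>Undoes the shift and forgets a possible 0, so one \<open>J\<close> serves both
      cases.\<close>
    define J where "J = {i. Suc i \<in> I}"
    have finJ: "finite J" and sub: "J \<subseteq> {..<length xs}"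
      using I by (auto simp: T_def J_def intro: finite_subset[of _ "{..<length xs}"])
    have card_J: "card (Suc ` J) = card J" by (simp add: card_image)
    show "I \<in> ?f ` S (Suc j) \<union> ?g ` S j"
    proof (cases "0 \<in> I")
      case True
      then have eq: "I = ?g J"
        unfolding J_def by (auto simp: image_iff) (metis not0_implies_Suc)
      then have "card I = Suc (card J)"
        using finJ card_J by simp
      then show ?thesis using I eq sub by (auto simp: T_def S_def)
    next
      case False
      then have eq: "I = ?f J"
        unfolding J_def by (auto simp: image_iff) (metis not0_implies_Suc)
      then show ?thesis using I card_J sub by (auto simp: T_def S_def)
    qed
  next
    fix I assume "I \<in> ?f ` S (Suc j) \<union> ?g ` S j"
    then consider J where "J \<in> S (Suc j)" "I = ?f J" | J where "J \<in> S j" "I = ?g J" by blast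
    then show "I \<in> T"
    proof cases
      case 1
      then show ?thesis by (auto simp: S_def T_def card_image)
    next
      case 2
      then have "card I = Suc (card J)"
        using finI by (simp add: card_image)
      then show ?thesis using 2 by (auto simp: S_def T_def)
    qed
  qed
  then have "esym (Suc j) (x # xs) =
      (\<Sum>I \<in> ?f ` S (Suc j) \<union> ?g ` S j. \<Prod>i\<in>I. (x # xs) ! i)"
    unfolding esym_def T_def by simp
  also have "\<dots> = (\<Sum>I \<in> ?f ` S (Suc j). \<Prod>i\<in>I. (x # xs) ! i)
      + (\<Sum>I \<in> ?g ` S j. \<Prod>i\<in>I. (x # xs) ! i)"
    \<comment> \<open>Disjoint, since 0 lies in every set of the second family and in none of the
      first.\<close>
    by (rule sum.union_disjoint) (use fin in auto)
  also have "(\<Sum>I \<in> ?f ` S (Suc j). \<Prod>i\<in>I. (x # xs) ! i) = esym (Suc j) xs"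
    unfolding sum.reindex[OF inj_f] by (simp add: prod.reindex esym_def S_def)
  also have "(\<Sum>I \<in> ?g ` S j. \<Prod>i\<in>I. (x # xs) ! i) = (\<Sum>I \<in> S j. x * (\<Prod>i\<in>I. xs ! i))"
    unfolding sum.reindex[OF inj_g]
    by (intro sum.cong) (simp_all add: finI prod.reindex)
  also have "\<dots> = x * esym j xs"
    by (simp add: esym_def S_def sum_distrib_left)
  finally show ?thesis .
qed

text \<open>By \<open>esym_Cons\<close>, each prepended 1 adds the elementary symmetric sum of
  degree \<open>k - 1\<close> of the list behind it. For the first 1 this is positive by
  \<open>esym_pos\<close>; later ones cannot decrease the value.\<close>

lemma esym_replicate_one_append_less:
  assumes "1 \<le> k" "k \<le> length xs" "\<forall>x\<in>set xs. 1 \<le> x" "0 < d"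
  shows "esym k xs < esym k (replicate d 1 @ xs)"
  using \<open>0 < d\<close>
proof (induction d rule: nat_induct_non_zero)
  case (Suc d)
  from \<open>1 \<le> k\<close> obtain j where "k = Suc j" by (cases k) auto
  with Suc show ?case by (simp add: esym_Cons)
next
  case 1
  from \<open>1 \<le> k\<close> obtain j where j: "k = Suc j" by (cases k) auto
  with assms have "0 < esym j xs" by (intro esym_pos) auto
  with j show ?case by (simp add: esym_Cons)
qed

text \<open>A sorted list is determined by its multiset, and both sides are sorted. Hence a solution
  is known once its entries above 1 and its number of ones are known.\<close>

lemma sorted_pos_decomp:
  fixes xs :: "nat list"
  assumes "sorted xs" "\<forall>x\<in>set xs. 1 \<le> x"
  shows "xs = replicate (count (mset xs) 1) 1
    @ sorted_list_of_multiset (filter_mset ((<) 1) (mset xs))"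
proof -
  let ?ys = "sorted_list_of_multiset (filter_mset ((<) 1) (mset xs))"
  let ?zs = "replicate (count (mset xs) 1) 1 @ ?ys"
  have "mset ?zs = mset xs"
  proof (rule multiset_eqI)
    fix a
    show "count (mset ?zs) a = count (mset xs) a"
      using assms(2) by (cases a rule: linorder_cases[of _ 1]) (auto simp: count_eq_zero_iff)
  qed
  moreover have "sorted ?zs"
    by (auto simp: sorted_append sorted_replicate)
  ultimately show ?thesis
    using assms(1) by (metis properties_for_sort)
qed

lemma prod_mset_filter_gt_one:
  fixes A :: "nat multiset"
  assumes "\<forall>a\<in>#A. 1 \<le> a"
  shows "prod_mset (filter_mset ((<) 1) A) = prod_mset A"
  using assms by (induction A) (auto simp: not_less dest: le_antisym)

text \<open>Each factor divides \<open>m\<close>, so it is at most \<open>m\<close>. Each further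
  factor at least doubles the product, so there are fewer than \<open>m\<close> factors. Only
  finitely many lists meet both bounds.\<close>

lemma finite_factorizations:
  assumes "1 \<le> (m::nat)"
  shows "finite {A :: nat multiset. (\<forall>a\<in>#A. 1 < a) \<and> prod_mset A = m}"
proof (rule finite_subset)
  show "finite (mset ` {xs. set xs \<subseteq> {..m} \<and> length xs \<le> m})"
    by (intro finite_imageI finite_lists_length_le) simp
  have size: "size A < prod_mset A" if "\<forall>a\<in>#A. 1 < a" for A :: "nat multiset"
    using that
  proof (induction A)
    case (add a A)
    then have "2 * prod_mset A \<le> a * prod_mset A" and "size A < prod_mset A"
      by (auto intro!: mult_le_mono1)
    then have "Suc (size A) < a * prod_mset A" by linarith
    then show ?case by simp
  qed simp
  show "{A :: nat multiset. (\<forall>a\<in>#A. 1 < a) \<and> prod_mset A = m}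
      \<subseteq> mset ` {xs. set xs \<subseteq> {..m} \<and> length xs \<le> m}"
  proof safe
    fix A :: "nat multiset"
    assume A: "\<forall>a\<in>#A. 1 < a" "m = prod_mset A"
    obtain xs where xs: "A = mset xs" by (metis ex_mset)
    have "a \<le> m" if "a \<in># A" for a
      using assms A(2) dvd_prod_mset[OF that] by (auto intro: dvd_imp_le)
    with xs size[OF A(1)] A(2)
    show "A \<in> mset ` {xs. set xs \<subseteq> {..prod_mset A} \<and> length xs \<le> prod_mset A}"
      by (intro image_eqI[of _ _ xs]) auto
  qed
qed

lemma inj_on_sol:
  assumes "1 \<le> k"
  shows "inj_on (\<lambda>xs. filter_mset ((<) 1) (mset xs)) (\<Union>n\<in>{k<..}. sol k n)"
proof (rule inj_onI)
  fix xs ys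
  assume xs: "xs \<in> (\<Union>n\<in>{k<..}. sol k n)" and ys: "ys \<in> (\<Union>n\<in>{k<..}. sol k n)"
    and eq: "filter_mset ((<) 1) (mset xs) = filter_mset ((<) 1) (mset ys)"
  \<comment> \<open>Solutions with the same image share the tail \<open>zs\<close> and can differ
    only in the number of leading ones. Applied in both directions, this forces the two numbers to
    agree.\<close>
  have no_longer: "\<not> a < b"
    if sols: "replicate a 1 @ zs \<in> (\<Union>n\<in>{k<..}. sol k n)" "replicate b 1 @ zs \<in> (\<Union>n\<in>{k<..}. sol k n)"
    for a b zs
  proof
    assume "a < b"
    then have b: "replicate b 1 @ zs = replicate (b - a) 1 @ (replicate a 1 @ zs)"
      by (simp flip: append_assoc replicate_add)
    \<comment> \<open>The defining equation turns \<open>esym k\<close> into the full product, which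
      does not see the ones.\<close>
    have "esym k (replicate c 1 @ zs) = prod_list zs"
      if "replicate c 1 @ zs \<in> (\<Union>n\<in>{k<..}. sol k n)" for c
      using that esym_length[of "replicate c 1 @ zs"] by (auto simp: sol_def)
    then have "esym k (replicate a 1 @ zs) = esym k (replicate b 1 @ zs)"
      using sols by metis
    moreover have "esym k (replicate a 1 @ zs) < esym k (replicate b 1 @ zs)"
      unfolding b using assms sols(1) \<open>a < b\<close>
      by (intro esym_replicate_one_append_less) (auto simp: sol_def)
    ultimately show False by simp
  qed
  define zs where "zs = sorted_list_of_multiset (filter_mset ((<) 1) (mset xs))"
  have "xs = replicate (count (mset xs) 1) 1 @ zs"
    unfolding zs_def using xs by (intro sorted_pos_decomp) (auto simp: sol_def)
  moreover have "ys = replicate (count (mset ys) 1) 1 @ zs"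
    unfolding zs_def eq using ys by (intro sorted_pos_decomp) (auto simp: sol_def)
  ultimately show "xs = ys"
    using no_longer xs ys by (metis linorder_neqE_nat)
qed

text \<open>
  In both bounds an infinite solution set would have \<^const>\<open>card\<close> equal to 0, so the finiteness
  of \<^term>\<open>sol k n\<close> does not have to be established.
\<close>

lemma num_sol_le_max_entry_power:
  assumes "0 < n"
  shows "num_sol k n \<le> max_entry k n ^ n"
proof (cases "finite (sol k n)")
  case True
  have "sol k n \<subseteq> {xs. set xs \<subseteq> {1..max_entry k n} \<and> length xs = n}"
  proof
    fix xs assume xs: "xs \<in> sol k n"
    have "last xs \<le> max_entry k n"
      unfolding max_entry_def Setcompr_eq_image using True xs by (intro Max_ge) auto
    moreover have "x \<le> last xs" if "x \<in> set xs" for x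
    proof -
      have "xs = butlast xs @ [last xs]" using that by (cases xs) auto
      moreover have "sorted xs" using xs by (simp add: sol_def)
      ultimately have "\<forall>x \<in> set (butlast xs @ [last xs]). x \<le> last xs"
        by (metis (no_types, lifting) Un_iff empty_iff insert_iff list.set le_refl set_append sorted_append)
      with \<open>xs = butlast xs @ [last xs]\<close> that show ?thesis by metis
    qed
    ultimately show "xs \<in> {xs. set xs \<subseteq> {1..max_entry k n} \<and> length xs = n}"
      using xs by (fastforce simp: sol_def)
  qed
  from card_mono[OF _ this] show ?thesis
    by (simp add: num_sol_def card_lists_length_eq finite_lists_length_eq)
qed (simp add: num_sol_def)

text \<open>Stated for any finite set \<open>N\<close> of lengths above \<open>k\<close>, which
  keeps the real bound out of the counting argument.\<close>

lemma sum_num_sol_le: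
  assumes "1 \<le> k" and "finite N" and N: "N \<subseteq> {k<..}"
  shows "(\<Sum>n\<in>N. num_sol k n) \<le> (\<Sum>l = 1..Max (max_product k ` N). num_factorizations l)"
proof -
  let ?M = "Max (max_product k ` N)"
  let ?h = "\<lambda>xs. filter_mset ((<) 1) (mset xs)"
  define F where "F l = {A :: nat multiset. (\<forall>a\<in>#A. 1 < a) \<and> prod_mset A = l}" for l
  \<comment> \<open>Discarded lengths contribute 0 to the sum. For the others, finiteness permits
    counting the union and makes \<open>max_product k n\<close> a genuine upper bound.\<close>
  define N' where "N' = {n\<in>N. finite (sol k n)}"
  have fin: "finite N'" using assms(2) by (simp add: N'_def)
  have "(\<Sum>n\<in>N. num_sol k n) = (\<Sum>n\<in>N'. card (sol k n))"
    by (rule sum.mono_neutral_cong_right) (use assms(2) in \<open>auto simp: N'_def num_sol_def\<close>)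
  \<comment> \<open>Solution sets for different \<open>n\<close> are disjoint because their lists
    have different lengths.\<close>
  also have "\<dots> = card (\<Union>n\<in>N'. sol k n)"
    by (rule card_UN_disjoint[symmetric]) (use fin in \<open>auto simp: N'_def sol_def\<close>)
  also have "\<dots> \<le> card (\<Union>l\<in>{1..?M}. F l)"
  proof (rule card_inj_on_le)
    show "inj_on ?h (\<Union>n\<in>N'. sol k n)"
      by (rule inj_on_subset[OF inj_on_sol[OF assms(1)]]) (use N in \<open>auto simp: N'_def\<close>)
    show "finite (\<Union>l\<in>{1..?M}. F l)"
      using finite_factorizations by (auto simp: F_def)
    show "?h ` (\<Union>n\<in>N'. sol k n) \<subseteq> (\<Union>l\<in>{1..?M}. F l)"
    proof safe
      fix n xs assume n: "n \<in> N'" and xs: "xs \<in> sol k n"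
      have pos: "\<forall>x\<in>set xs. 1 \<le> x" using xs by (simp add: sol_def)
      have "prod_list xs \<le> max_product k n"
        unfolding max_product_def Setcompr_eq_image
        using n xs by (intro Max_ge) (auto simp: N'_def)
      also have "\<dots> \<le> ?M"
        using n assms(2) by (intro Max_ge) (auto simp: N'_def)
      finally have "prod_list xs \<le> ?M" .
      moreover have "1 \<le> prod_list xs"
        using pos by (induction xs) auto
      moreover have "?h xs \<in> F (prod_list xs)"
        using prod_mset_filter_gt_one[of "mset xs"] pos by (auto simp: F_def prod_mset_prod_list)
      ultimately show "?h xs \<in> (\<Union>l\<in>{1..?M}. F l)" by auto
    qed
  qed
  also have "\<dots> \<le> (\<Sum>l = 1..?M. card (F l))"
    by (rule card_UN_le) simp
  finally show ?thesis
    by (simp add: num_factorizations_def F_def)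
qed

theorem lemma2:
  shows "(\<forall>k n :: nat. 1 \<le> k \<and> k < n \<longrightarrow> num_sol k n \<le> max_entry k n ^ n) \<and>
    (\<forall>(k :: nat) (x :: real). 1 \<le> k \<and> real k + 1 \<le> x \<longrightarrow>
      (\<Sum>n | k < n \<and> real n \<le> x. num_sol k n)
        \<le> (\<Sum>l = 1..Max {max_product k n | n. k < n \<and> real n \<le> x}. num_factorizations l))"
proof (intro conjI allI impI)
  fix k n :: nat
  assume "1 \<le> k \<and> k < n"
  then show "num_sol k n \<le> max_entry k n ^ n"
    by (intro num_sol_le_max_entry_power) simp
next
  fix k :: nat and x :: real
  assume "1 \<le> k \<and> real k + 1 \<le> x"
  moreover have "finite {n. k < n \<and> real n \<le> x}"
    by (rule finite_subset[of _ "{..nat \<lfloor>x\<rfloor>}"]) (auto simp: le_nat_floor)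
  ultimately show "(\<Sum>n | k < n \<and> real n \<le> x. num_sol k n)
      \<le> (\<Sum>l = 1..Max {max_product k n | n. k < n \<and> real n \<le> x}. num_factorizations l)"
    unfolding setcompr_eq_image by (intro sum_num_sol_le) auto
qed

end
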